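(* Let $a,b,c$ be nonzero integers and consider the periodic continued fraction $\left[\,\overline{\frac{b}{a},\frac{b}{c}}\,\right]=\frac ba+\cfrac{1}{\frac bc+\cfrac{1}{\frac ba+\cfrac{1}{\frac bc+\cdots}}}$, with partial quotients $c_{2k}=b/a$, $c_{2k+1}=b/c$, and let $(C_n)_{n\ge0}$ be its sequence of convergents, $C_n=p_n/q_n$, where $p_0=c_0$, $p_1=c_0c_1+1$, $q_0=1$, $q_1=c_1$, $p_n=c_np_{n-1}+p_{n-2}$, $q_n=c_nq_{n-1}+q_{n-2}$ for $n\ge2$. Let $\alpha$ be the root of larger modulus of $f(t)=at^2-bt-c$, and let $F$ be the Fibonacci sequence ($F_0=0$, $F_1=1$, $F_n=F_{n-1}+F_{n-2}$). Then: (1) $(C_{F_{n+2}-1})_{n\ge0}$ is the sequence of approximations of $\alpha$ given by the secant method for $f$ started from $C_0$ and $C_1$; (2) $(C_{2^n-1})_{n\ge0}$ is the sequence of Newton approximations of $\alpha$ for $f$ started from $C_0$; (3) $(C_{3^n-1})_{n\ge0}$ is the sequence of Halley approximations of $\alpha$ for $f$ started from $C_0$.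
   Context: Secant method: $y_n=y_{n-1}-\frac{f(y_{n-1})(y_{n-1}-y_{n-2})}{f(y_{n-1})-f(y_{n-2})}$, which for $f(t)=at^2-bt-c$ equals $\frac{ay_{n-1}y_{n-2}+c}{a y_{n-1}+a y_{n-2}-b}$. Newton's method: $y_n=y_{n-1}-f(y_{n-1})/f'(y_{n-1})$. Halley's method: $y_n=y_{n-1}-\frac{2f(y_{n-1})f'(y_{n-1})}{2f'(y_{n-1})^2-f(y_{n-1})f''(y_{n-1})}$. The statements are understood whenever all quantities are defined (nonzero denominators). *)

theory Defs
  imports "HOL-Analysis.Analysis" "HOL-Number_Theory.Fib"
begin

fun cf_num :: "(nat \<Rightarrow> 'a::field) \<Rightarrow> nat \<Rightarrow> 'a" where
  "cf_num c 0 = c 0"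
| "cf_num c (Suc 0) = c 0 * c 1 + 1"
| "cf_num c (Suc (Suc n)) = c (Suc (Suc n)) * cf_num c (Suc n) + cf_num c n"

fun cf_den :: "(nat \<Rightarrow> 'a::field) \<Rightarrow> nat \<Rightarrow> 'a" where
  "cf_den c 0 = 1"
| "cf_den c (Suc 0) = c 1"
| "cf_den c (Suc (Suc n)) = c (Suc (Suc n)) * cf_den c (Suc n) + cf_den c n"

text \<open>A junk value when the denominator \<open>cf_den c n\<close> is zero.\<close>

definition cf_convergent :: "(nat \<Rightarrow> 'a::field) \<Rightarrow> nat \<Rightarrow> 'a" where
  "cf_convergent c n = cf_num c n / cf_den c n"

definition periodic_quotients :: "int \<Rightarrow> int \<Rightarrow> int \<Rightarrow> nat \<Rightarrow> real" where
  "periodic_quotients a b c n = (if even n then of_int b / of_int a else of_int b / of_int c)"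

text \<open>Polymorphic in the field, since the iterations run over the reals whereas the roots are
  compared by modulus over the complex numbers.\<close>

definition quad :: "int \<Rightarrow> int \<Rightarrow> int \<Rightarrow> 'a::field \<Rightarrow> 'a" where
  "quad a b c t = of_int a * t ^ 2 - of_int b * t - of_int c"

text \<open>A double root counts as the root of larger modulus; two distinct roots of equal modulus
  (such as complex conjugates) do not.\<close>

definition is_larger_modulus_root :: "(complex \<Rightarrow> complex) \<Rightarrow> complex \<Rightarrow> bool" where
  "is_larger_modulus_root f \<alpha> \<longleftrightarrow>
     f \<alpha> = 0 \<and> (\<forall>\<beta>. f \<beta> = 0 \<and> \<beta> \<noteq> \<alpha> \<longrightarrow> norm \<beta> < norm \<alpha>)"

text \<open>Division by zero being total, each iteration comes with a predicate saying that
  no denominator vanishes in the computation of its terms up to index \<open>n\<close>.\<close>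

fun secant :: "('a::field \<Rightarrow> 'a) \<Rightarrow> 'a \<Rightarrow> 'a \<Rightarrow> nat \<Rightarrow> 'a" where
  "secant f y0 y1 0 = y0"
| "secant f y0 y1 (Suc 0) = y1"
| "secant f y0 y1 (Suc (Suc n)) =
     secant f y0 y1 (Suc n)
     - f (secant f y0 y1 (Suc n)) * (secant f y0 y1 (Suc n) - secant f y0 y1 n)
       / (f (secant f y0 y1 (Suc n)) - f (secant f y0 y1 n))"

definition secant_defined :: "('a::field \<Rightarrow> 'a) \<Rightarrow> 'a \<Rightarrow> 'a \<Rightarrow> nat \<Rightarrow> bool" where
  "secant_defined f y0 y1 n \<longleftrightarrow>
     (\<forall>k. k + 2 \<le> n \<longrightarrow> f (secant f y0 y1 (k + 1)) - f (secant f y0 y1 k) \<noteq> 0)"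

fun newton :: "('a::real_normed_field \<Rightarrow> 'a) \<Rightarrow> 'a \<Rightarrow> nat \<Rightarrow> 'a" where
  "newton f y0 0 = y0"
| "newton f y0 (Suc n) = newton f y0 n - f (newton f y0 n) / deriv f (newton f y0 n)"

definition newton_defined :: "('a::real_normed_field \<Rightarrow> 'a) \<Rightarrow> 'a \<Rightarrow> nat \<Rightarrow> bool" where
  "newton_defined f y0 n \<longleftrightarrow> (\<forall>k<n. deriv f (newton f y0 k) \<noteq> 0)"

definition halley_den :: "('a::real_normed_field \<Rightarrow> 'a) \<Rightarrow> 'a \<Rightarrow> 'a" where
  "halley_den f y = 2 * (deriv f y) ^ 2 - f y * deriv (deriv f) y"

fun halley :: "('a::real_normed_field \<Rightarrow> 'a) \<Rightarrow> 'a \<Rightarrow> nat \<Rightarrow> 'a" where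
  "halley f y0 0 = y0"
| "halley f y0 (Suc n) =
     halley f y0 n
     - 2 * f (halley f y0 n) * deriv f (halley f y0 n) / halley_den f (halley f y0 n)"

definition halley_defined :: "('a::real_normed_field \<Rightarrow> 'a) \<Rightarrow> 'a \<Rightarrow> nat \<Rightarrow> bool" where
  "halley_defined f y0 n \<longleftrightarrow> (\<forall>k<n. halley_den f (halley f y0 k) \<noteq> 0)"

end

theory Submission
  imports Defs
begin

text \<open>Let \<open>U\<close> be the Lucas sequence with \<open>U\<^sub>0 = 0\<close>, \<open>U\<^sub>1 = 1\<close> and
  characteristic polynomial \<open>t\<^sup>2 - b t - a c\<close>. The convergents are
  \<open>C\<^sub>m\<^sub>-\<^sub>1 = U\<^sub>m\<^sub>+\<^sub>1 / (a U\<^sub>m)\<close>, and the addition formulas of \<open>U\<close> show that a secant step leads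
  from the indices \<open>m\<close> and \<open>n\<close> to \<open>m + n\<close>, whereas Newton and Halley steps lead from \<open>m\<close> to \<open>2 m\<close>
  and \<open>3 m\<close>. The denominators of these steps are multiples of \<open>U\<^sub>m\<^sub>+\<^sub>n\<close>,
  \<open>U\<^sub>2\<^sub>m\<close> and \<open>U\<^sub>3\<^sub>m\<close>. With \<open>x = a \<alpha>\<close> and \<open>y\<close> the other characteristic root,
  \<open>U\<^sub>m\<^sub>+\<^sub>1 = x U\<^sub>m + y\<^sup>m\<close>, so everything is defined and converges to \<open>\<alpha>\<close> once \<open>y\<^sup>m / U\<^sub>m\<close>
  tends to \<open>0\<close>.\<close>

section \<open>Lucas sequences: addition formulas, norm form, Binet formula\<close>

fun lucas_U :: "'a::comm_ring_1 \<Rightarrow> 'a \<Rightarrow> nat \<Rightarrow> 'a" where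
  "lucas_U P Q 0 = 0"
| "lucas_U P Q (Suc 0) = 1"
| "lucas_U P Q (Suc (Suc n)) = P * lucas_U P Q (Suc n) - Q * lucas_U P Q n"

lemma of_int_lucas_U: "of_int (lucas_U P Q n) = lucas_U (of_int P) (of_int Q) n"
  by (induction P Q n rule: lucas_U.induct) auto

text \<open>These are entries of a product of powers of the companion matrix; the induction needs
  both at once. The term with \<open>P\<close> avoids the predecessor index of the usual
  form.\<close>

lemma lucas_U_add_aux:
  "lucas_U P Q (m + n) = lucas_U P Q m * lucas_U P Q (Suc n) + lucas_U P Q (Suc m) * lucas_U P Q n
      - P * lucas_U P Q m * lucas_U P Q n \<and>
   lucas_U P Q (Suc (m + n)) = lucas_U P Q (Suc m) * lucas_U P Q (Suc n)
      - Q * lucas_U P Q m * lucas_U P Q n"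
proof (induction m)
  case (Suc m)
  note IH = conjunct1[OF Suc] conjunct2[OF Suc]
  show ?case unfolding add_Suc lucas_U.simps(3) IH by (simp add: algebra_simps)
qed simp

lemmas lucas_U_add = lucas_U_add_aux[THEN conjunct1]
  and lucas_U_Suc_add = lucas_U_add_aux[THEN conjunct2]

text \<open>The form \<open>s^2 - P * t * s + Q * t^2\<close> is multiplied by \<open>Q\<close> when
  the pair \<open>(t, s)\<close> of consecutive terms advances by one index.\<close>

lemma lucas_U_norm:
  "(lucas_U P Q (Suc m))\<^sup>2 - P * lucas_U P Q m * lucas_U P Q (Suc m) + Q * (lucas_U P Q m)\<^sup>2 = Q ^ m"
proof (induction m)
  case (Suc m)
  have "(lucas_U P Q (Suc (Suc m)))\<^sup>2 - P * lucas_U P Q (Suc m) * lucas_U P Q (Suc (Suc m))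
      + Q * (lucas_U P Q (Suc m))\<^sup>2
    = Q * ((lucas_U P Q (Suc m))\<^sup>2 - P * lucas_U P Q m * lucas_U P Q (Suc m) + Q * (lucas_U P Q m)\<^sup>2)"
    by (simp add: algebra_simps power2_eq_square)
  then show ?case by (simp add: Suc)
qed simp

text \<open>After expansion the terms with \<open>lucas_U P Q (Suc m)\<close> cancel, and the
  coefficient of \<open>lucas_U P Q m\<close> is the norm form at \<open>n\<close>.\<close>

lemma lucas_U_dOcagne:
  "lucas_U P Q (m + n) * lucas_U P Q (Suc n) - lucas_U P Q (Suc (m + n)) * lucas_U P Q n
    = Q ^ n * lucas_U P Q m"
  unfolding lucas_U_add lucas_U_Suc_add
  by (simp add: lucas_U_norm[of P Q n, symmetric] algebra_simps power2_eq_square)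

text \<open>A term minus \<open>x\<close> times its predecessor is geometric with ratio
  \<open>y\<close>.\<close>

lemma lucas_U_Suc_eq_root:
  "lucas_U (x + y) (x * y) (Suc m) = x * lucas_U (x + y) (x * y) m + y ^ m"
proof (induction m)
  case (Suc m)
  then have "y * lucas_U (x + y) (x * y) (Suc m) = x * y * lucas_U (x + y) (x * y) m + y ^ Suc m"
    by (simp add: algebra_simps)
  then show ?case by (simp add: algebra_simps)
qed simp

text \<open>Compare the preceding identity with its version for exchanged roots.\<close>

lemma lucas_U_binet: "(x - y) * lucas_U (x + y) (x * y) m = x ^ m - y ^ m"
  using lucas_U_Suc_eq_root[of x y m] lucas_U_Suc_eq_root[of y x m]
  by (simp add: algebra_simps)

lemma lucas_U_double_root: "lucas_U (x + x) (x * x) (Suc m) = of_nat (Suc m) * x ^ m"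
proof (induction m)
  case (Suc m)
  show ?case
    unfolding lucas_U_Suc_eq_root[of x x "Suc m"] Suc by (simp add: algebra_simps)
qed simp

section \<open>Nonvanishing and decay when one characteristic root dominates\<close>

lemma lucas_U_nonzero:
  fixes x y :: complex
  assumes "x \<noteq> 0" and dom: "y = x \<or> norm y < norm x" and "m > 0"
  shows "lucas_U (x + y) (x * y) m \<noteq> 0"
proof (cases "y = x")
  case True
  obtain k where "m = Suc k" using \<open>m > 0\<close> gr0_implies_Suc by blast
  then show ?thesis
    using \<open>x \<noteq> 0\<close> True lucas_U_double_root[of x k] of_nat_neq_0[where 'a=complex, of k] by simp
next
  case False
  then have "norm (y ^ m) < norm (x ^ m)"
    using dom \<open>m > 0\<close> by (simp add: norm_power power_strict_mono)
  then show ?thesis using lucas_U_binet[of x y m] by auto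
qed

text \<open>For a double root the quotient is \<open>x / m\<close>; for distinct roots, dividing
  Binet's formula by \<open>x ^ m\<close> leaves powers of \<open>y / x\<close>, whose modulus is
  below 1.\<close>

lemma root_power_over_lucas_U_tendsto_0:
  fixes x y :: complex
  assumes "x \<noteq> 0" and dom: "y = x \<or> norm y < norm x"
  shows "(\<lambda>m. y ^ m / lucas_U (x + y) (x * y) m) \<longlonglongrightarrow> 0"
proof (cases "y = x")
  case True
  have "x ^ Suc m / lucas_U (x + x) (x * x) (Suc m) = x * inverse (of_nat (Suc m))" for m
    unfolding lucas_U_double_root using \<open>x \<noteq> 0\<close> by (simp add: divide_inverse)
  moreover have "(\<lambda>m. x * inverse (of_nat (Suc m))) \<longlonglongrightarrow> 0"
    using tendsto_mult_right_zero[OF LIMSEQ_Suc[OF lim_inverse_n]] by simp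
  ultimately have "(\<lambda>m. x ^ Suc m / lucas_U (x + x) (x * x) (Suc m)) \<longlonglongrightarrow> 0"
    by presburger
  then show ?thesis unfolding True by (rule LIMSEQ_imp_Suc)
next
  case False
  define r where "r = y / x"
  have "norm r < 1"
    using False dom \<open>x \<noteq> 0\<close> by (auto simp: r_def norm_divide divide_simps)
  then have "(\<lambda>m. r ^ m) \<longlonglongrightarrow> 0" by (rule LIMSEQ_power_zero)
  then have "(\<lambda>m. (x - y) * r ^ m / (1 - r ^ m)) \<longlonglongrightarrow> (x - y) * 0 / (1 - 0)"
    by (intro tendsto_divide tendsto_mult tendsto_diff tendsto_const) auto
  \<comment> \<open>At \<open>m = 0\<close> both sides are divisions by zero, hence 0.\<close>
  moreover have "y ^ m / lucas_U (x + y) (x * y) m = (x - y) * r ^ m / (1 - r ^ m)" for m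
  proof -
    have "lucas_U (x + y) (x * y) m = (x ^ m - y ^ m) / (x - y)"
      using lucas_U_binet[of x y m] False by (simp add: field_simps)
    moreover have "y ^ m = x ^ m * r ^ m"
      using \<open>x \<noteq> 0\<close> by (simp add: r_def power_divide)
    ultimately have "y ^ m / lucas_U (x + y) (x * y) m
        = (x ^ m * ((x - y) * r ^ m)) / (x ^ m * (1 - r ^ m))"
      by (simp add: algebra_simps)
    then show ?thesis using \<open>x \<noteq> 0\<close> by simp
  qed
  ultimately show ?thesis by simp
qed

lemma deriv_quad: "deriv (quad a b c) = (\<lambda>t::'a::real_normed_field. 2 * of_int a * t - of_int b)"
proof
  fix t :: 'a
  have "(quad a b c has_field_derivative 2 * of_int a * t - of_int b) (at t)"
    unfolding quad_def[abs_def] by (auto intro!: derivative_eq_intros)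
  then show "deriv (quad a b c) t = 2 * of_int a * t - of_int b" by (rule DERIV_imp_deriv)
qed

lemma deriv_deriv_quad:
  "deriv (deriv (quad a b c)) = (\<lambda>t::'a::real_normed_field. 2 * of_int a)"
proof
  fix t :: 'a
  have "((\<lambda>t. 2 * of_int a * t - of_int b) has_field_derivative 2 * of_int a) (at t)"
    by (auto intro!: derivative_eq_intros)
  then show "deriv (deriv (quad a b c)) t = 2 * of_int a"
    unfolding deriv_quad by (rule DERIV_imp_deriv)
qed

section \<open>Convergents as quotients of Lucas numbers\<close>

locale quadratic_cf =
  fixes a b c :: int
  assumes nonzero: "a \<noteq> 0" "b \<noteq> 0" "c \<noteq> 0"
begin

text \<open>The characteristic roots are \<open>a\<close> times the roots of the quadratic: their
  sum is \<open>b\<close>, their product \<open>- a * c\<close>.\<close>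

definition U :: "nat \<Rightarrow> real" where
  "U = lucas_U (of_int b) (- of_int a * of_int c)"

text \<open>The index is one ahead of that of the convergents, so that the methods act on it by
  plain addition and multiplication.\<close>

definition D :: "nat \<Rightarrow> real" where
  "D m = U (Suc m) / (of_int a * U m)"

abbreviation f :: "real \<Rightarrow> real" where
  "f \<equiv> quad a b c"

lemma U_simps: "U 0 = 0" "U (Suc 0) = 1"
  "U (Suc (Suc n)) = of_int b * U (Suc n) + of_int a * of_int c * U n"
  by (simp_all add: U_def)

lemma U_add: "U (m + n) = U m * U (Suc n) + U (Suc m) * U n - of_int b * U m * U n"
  unfolding U_def by (rule lucas_U_add)

lemma U_Suc_add: "U (Suc (m + n)) = U (Suc m) * U (Suc n) + of_int a * of_int c * U m * U n"
  unfolding U_def by (simp add: lucas_U_Suc_add)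

text \<open>Clearing the denominators of \<open>b / c\<close> and \<open>b / a\<close> in turn makes
  the alternating recurrence that of \<open>U\<close>; the factors \<open>c\<close> and
  \<open>a\<close> accumulate.\<close>

lemma cf_den_U_aux:
  "cf_den (periodic_quotients a b c) (2 * k) * (of_int a * of_int c) ^ k = U (Suc (2 * k)) \<and>
   cf_den (periodic_quotients a b c) (Suc (2 * k)) * (of_int c * (of_int a * of_int c) ^ k)
     = U (Suc (Suc (2 * k)))"
proof (induction k)
  case 0
  show ?case using nonzero by (simp add: periodic_quotients_def U_simps)
next
  case (Suc k)
  let ?c = "periodic_quotients a b c" and ?w = "(of_int a * of_int c :: real) ^ k"
  have "cf_den ?c (2 * Suc k) * (of_int a * of_int c) ^ Suc k
      = of_int b * (cf_den ?c (Suc (2 * k)) * (of_int c * ?w))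
        + of_int a * of_int c * (cf_den ?c (2 * k) * ?w)"
    using nonzero by (simp add: periodic_quotients_def field_simps)
  then have even_step: "cf_den ?c (2 * Suc k) * (of_int a * of_int c) ^ Suc k
      = U (Suc (2 * Suc k))"
    by (simp only: Suc U_simps mult_Suc_right add_2_eq_Suc)
  have "cf_den ?c (Suc (2 * Suc k))
      = of_int b / of_int c * cf_den ?c (2 * Suc k) + cf_den ?c (Suc (2 * k))"
    by (simp add: periodic_quotients_def)
  then have "cf_den ?c (Suc (2 * Suc k)) * (of_int c * (of_int a * of_int c) ^ Suc k)
      = of_int b * (cf_den ?c (2 * Suc k) * (of_int a * of_int c) ^ Suc k)
        + of_int a * of_int c * (cf_den ?c (Suc (2 * k)) * (of_int c * ?w))"
    using nonzero by (simp only:) (simp del: cf_den.simps add: field_simps)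
  then have "cf_den ?c (Suc (2 * Suc k)) * (of_int c * (of_int a * of_int c) ^ Suc k)
      = U (Suc (Suc (2 * Suc k)))"
    unfolding even_step conjunct2[OF Suc] by (simp add: U_simps)
  then show ?case using even_step by simp
qed

text \<open>Here the first quotient \<open>b / a\<close> contributes too, so each factor is
  \<open>a\<close> times the one for \<open>cf_den\<close>.\<close>

lemma cf_num_U_aux:
  "cf_num (periodic_quotients a b c) (2 * k) * (of_int a * (of_int a * of_int c) ^ k)
     = U (Suc (Suc (2 * k))) \<and>
   cf_num (periodic_quotients a b c) (Suc (2 * k)) * (of_int a * of_int c) ^ Suc k
     = U (Suc (Suc (Suc (2 * k))))"
proof (induction k)
  case 0
  show ?case using nonzero by (simp add: periodic_quotients_def U_simps field_simps)
next
  case (Suc k)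
  let ?c = "periodic_quotients a b c" and ?w = "(of_int a * of_int c :: real) ^ k"
  have even_step: "cf_num ?c (2 * Suc k) * (of_int a * (of_int a * of_int c) ^ Suc k)
      = U (Suc (Suc (2 * Suc k)))"
  proof -
    have "cf_num ?c (2 * Suc k) * (of_int a * (of_int a * of_int c) ^ Suc k)
        = of_int b * (cf_num ?c (Suc (2 * k)) * (of_int a * of_int c) ^ Suc k)
          + of_int a * of_int c * (cf_num ?c (2 * k) * (of_int a * ?w))"
      using nonzero by (simp add: periodic_quotients_def field_simps)
    then show ?thesis by (simp only: Suc U_simps mult_Suc_right add_2_eq_Suc)
  qed
  have "cf_num ?c (Suc (2 * Suc k)) * (of_int a * of_int c) ^ Suc (Suc k)
      = of_int b * (cf_num ?c (2 * Suc k) * (of_int a * (of_int a * of_int c) ^ Suc k))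
        + of_int a * of_int c * (cf_num ?c (Suc (2 * k)) * (of_int a * of_int c) ^ Suc k)"
  proof -
    have "cf_num ?c (Suc (2 * Suc k))
        = of_int b / of_int c * cf_num ?c (2 * Suc k) + cf_num ?c (Suc (2 * k))"
      by (simp add: periodic_quotients_def)
    then show ?thesis using nonzero by (simp only:) (simp del: cf_num.simps add: field_simps)
  qed
  then have "cf_num ?c (Suc (2 * Suc k)) * (of_int a * of_int c) ^ Suc (Suc k)
      = U (Suc (Suc (Suc (2 * Suc k))))"
    unfolding even_step conjunct2[OF Suc] by (simp add: U_simps)
  then show ?case using even_step by simp
qed

lemma cf_den_eq_0_iff: "cf_den (periodic_quotients a b c) n = 0 \<longleftrightarrow> U (Suc n) = 0"
proof (cases "even n")
  case True
  then obtain k where "n = 2 * k" by blast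
  then show ?thesis using cf_den_U_aux[of k] nonzero by auto
next
  case False
  then obtain k where "n = Suc (2 * k)" by (auto elim: oddE)
  then show ?thesis using cf_den_U_aux[of k] nonzero by auto
qed

text \<open>The normalizing factors cancel up to \<open>a\<close>. If the denominator is zero, both
  sides are divisions by zero and agree.\<close>

lemma cf_convergent_eq_D: "cf_convergent (periodic_quotients a b c) n = D (Suc n)"
proof (cases "even n")
  case True
  then obtain k where k: "n = 2 * k" by blast
  show ?thesis
    unfolding k cf_convergent_def D_def
      conjunct1[OF cf_den_U_aux, symmetric] conjunct1[OF cf_num_U_aux, symmetric]
    using nonzero by simp
next
  case False
  then obtain k where k: "n = Suc (2 * k)" by (auto elim: oddE)
  show ?thesis
    unfolding k cf_convergent_def D_def
      conjunct2[OF cf_den_U_aux, symmetric] conjunct2[OF cf_num_U_aux, symmetric]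
    using nonzero by simp
qed

section \<open>Effect of one step of each method on the index\<close>

text \<open>The divided difference of \<open>f\<close> at \<open>s\<close> and \<open>t\<close> is
  \<open>a * (s + t) - b\<close>, which at \<open>D m\<close> and \<open>D n\<close> is the addition
  formula over \<open>U m * U n\<close>.\<close>

lemma secant_den:
  assumes "U m \<noteq> 0" "U n \<noteq> 0"
  shows "f (D m) - f (D n) = (D m - D n) * (U (m + n) / (U m * U n))"
proof -
  have "of_int a * (D m + D n) - of_int b = U (m + n) / (U m * U n)"
    using assms nonzero by (simp add: D_def U_add field_simps)
  moreover have "f s - f t = (s - t) * (of_int a * (s + t) - of_int b)" for s t
    by (simp add: quad_def algebra_simps power2_eq_square)
  ultimately show ?thesis by simp
qed

lemma secant_step:
  assumes "U m \<noteq> 0" "U n \<noteq> 0" "f (D m) - f (D n) \<noteq> 0"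
  shows "U (m + n) \<noteq> 0" "D m - f (D m) * (D m - D n) / (f (D m) - f (D n)) = D (m + n)"
proof -
  \<comment> \<open>The secant denominator is a product: its first factor cancels in the step, its
    second makes the new index admissible.\<close>
  have nz: "D m - D n \<noteq> 0" "U (m + n) \<noteq> 0"
    using assms secant_den[of m n] by auto
  then show "U (m + n) \<noteq> 0" by simp
  have "D m - f (D m) * (D m - D n) / (f (D m) - f (D n))
      = D m - f (D m) * (U m * U n) / U (m + n)"
    unfolding secant_den[OF assms(1,2)] using nz by simp
  also have "\<dots> = (D m * U (m + n) - f (D m) * (U m * U n)) / U (m + n)"
    using nz by (simp add: field_simps)
  also have "D m * U (m + n) - f (D m) * (U m * U n) = U (Suc (m + n)) / of_int a"
    using assms nonzero
    by (simp add: D_def quad_def U_add U_Suc_add field_simps power2_eq_square)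
  finally show "D m - f (D m) * (D m - D n) / (f (D m) - f (D n)) = D (m + n)"
    by (simp add: D_def)
qed

text \<open>This is the divided difference above at \<open>m = n\<close>.\<close>

lemma deriv_f_D:
  assumes "U m \<noteq> 0"
  shows "deriv f (D m) = U (2 * m) / (U m)\<^sup>2"
  using assms nonzero unfolding mult_2 U_add deriv_quad
  by (simp add: D_def field_simps power2_eq_square)

lemma newton_step:
  assumes "U m \<noteq> 0" "deriv f (D m) \<noteq> 0"
  shows "U (2 * m) \<noteq> 0" "D m - f (D m) / deriv f (D m) = D (2 * m)"
proof -
  show nz: "U (2 * m) \<noteq> 0" using assms deriv_f_D by auto
  have "D m - f (D m) / deriv f (D m) = (D m * U (2 * m) - f (D m) * (U m)\<^sup>2) / U (2 * m)"
    unfolding deriv_f_D[OF assms(1)] using nz by (simp add: field_simps)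
  also have "D m * U (2 * m) - f (D m) * (U m)\<^sup>2 = U (Suc (2 * m)) / of_int a"
    using assms nonzero unfolding mult_2 U_add U_Suc_add
    by (simp add: D_def quad_def field_simps power2_eq_square)
  finally show "D m - f (D m) / deriv f (D m) = D (2 * m)" by (simp add: D_def)
qed

text \<open>As the second derivative is \<open>2 * a\<close>, half the denominator is the squared
  derivative minus \<open>a * f\<close>; expanding \<open>U (m + (m + m))\<close> gives the same
  rational function of \<open>U m\<close> and \<open>U (Suc m)\<close>.\<close>

lemma halley_den_D:
  assumes "U m \<noteq> 0"
  shows "halley_den f (D m) = 2 * (U (3 * m) / U m ^ 3)"
proof -
  have m3: "3 * m = m + (m + m)" by simp
  show ?thesis
    using assms nonzero
    unfolding m3 U_add[of m "m + m"] halley_den_def deriv_deriv_quad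
    unfolding deriv_quad U_add U_Suc_add
    by (simp add: D_def quad_def field_simps power2_eq_square power3_eq_cube)
qed

lemma halley_step:
  assumes "U m \<noteq> 0" "halley_den f (D m) \<noteq> 0"
  shows "U (3 * m) \<noteq> 0" "D m - 2 * f (D m) * deriv f (D m) / halley_den f (D m) = D (3 * m)"
proof -
  show nz: "U (3 * m) \<noteq> 0" using assms halley_den_D by auto
  have m3: "3 * m = m + (m + m)" by simp
  have "D m - 2 * f (D m) * deriv f (D m) / halley_den f (D m)
      = (D m * U (3 * m) - f (D m) * U (2 * m) * U m) / U (3 * m)"
    unfolding halley_den_D[OF assms(1)] deriv_f_D[OF assms(1)]
    using nz assms(1) by (simp add: field_simps power2_eq_square power3_eq_cube)
  also have "D m * U (3 * m) - f (D m) * U (2 * m) * U m = U (Suc (3 * m)) / of_int a"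
    using assms nonzero unfolding m3 mult_2 U_add[of m "m + m"] U_Suc_add[of m "m + m"]
    unfolding U_add U_Suc_add
    by (simp add: D_def quad_def field_simps power2_eq_square power3_eq_cube)
  finally show "D m - 2 * f (D m) * deriv f (D m) / halley_den f (D m) = D (3 * m)"
    by (simp add: D_def)
qed

section \<open>Indices of the iterates\<close>

text \<open>The starting indices 1 and 2 are \<open>fib 2\<close> and \<open>fib 3\<close>, and each
  step adds the last two. Nonvanishing of \<open>U\<close> is drawn from definedness along the
  way.\<close>

lemma secant_eq_D:
  "secant_defined f (D 1) (D 2) n \<Longrightarrow>
    U (fib (n + 2)) \<noteq> 0 \<and> secant f (D 1) (D 2) n = D (fib (n + 2))"
proof (induction n rule: induct_nat_012)
  case 0
  show ?case by (simp add: U_simps numeral_2_eq_2)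
next
  case 1
  \<comment> \<open>\<open>U 2\<close> is \<open>b\<close>.\<close>
  show ?case using nonzero by (simp add: U_simps numeral_2_eq_2 numeral_3_eq_3)
next
  case (ge2 n)
  have "secant_defined f (D 1) (D 2) n" "secant_defined f (D 1) (D 2) (Suc n)"
    using ge2.prems by (auto simp: secant_defined_def)
  then have IH: "U (fib (n + 2)) \<noteq> 0" "secant f (D 1) (D 2) n = D (fib (n + 2))"
    "U (fib (n + 3)) \<noteq> 0" "secant f (D 1) (D 2) (Suc n) = D (fib (n + 3))"
    using ge2.IH by (simp_all add: numeral_3_eq_3)
  have "f (secant f (D 1) (D 2) (Suc n)) - f (secant f (D 1) (D 2) n) \<noteq> 0"
    using ge2.prems by (auto simp: secant_defined_def)
  then have "f (D (fib (n + 3))) - f (D (fib (n + 2))) \<noteq> 0" using IH by simp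
  note step = secant_step[OF IH(3,1) this]
  have "fib (n + 3) + fib (n + 2) = fib (Suc (Suc n) + 2)"
    by (simp add: numeral_3_eq_3)
  then show ?case using step IH by simp
qed

lemma newton_eq_D:
  "newton_defined f (D 1) n \<Longrightarrow> U (2 ^ n) \<noteq> 0 \<and> newton f (D 1) n = D (2 ^ n)"
proof (induction n)
  case (Suc n)
  then have "U (2 ^ n) \<noteq> 0" "newton f (D 1) n = D (2 ^ n)" "deriv f (D (2 ^ n)) \<noteq> 0"
    by (auto simp: newton_defined_def less_Suc_eq)
  then show ?case using newton_step[of "2 ^ n"] by simp
qed (simp add: U_simps)

lemma halley_eq_D:
  "halley_defined f (D 1) n \<Longrightarrow> U (3 ^ n) \<noteq> 0 \<and> halley f (D 1) n = D (3 ^ n)"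
proof (induction n)
  case (Suc n)
  then have "U (3 ^ n) \<noteq> 0" "halley f (D 1) n = D (3 ^ n)" "halley_den f (D (3 ^ n)) \<noteq> 0"
    by (auto simp: halley_defined_def less_Suc_eq)
  then show ?case using halley_step[of "3 ^ n"] by simp
qed (simp add: U_simps)

section \<open>Definedness of the methods when \<open>U\<close> vanishes only at 0\<close>

context
  assumes U_nonzero: "\<And>m. m > 0 \<Longrightarrow> U m \<noteq> 0"
begin

text \<open>By d'Ocagne's identity the cross difference is \<open>(- a * c) ^ n * U (m - n)\<close>,
  which is nonzero.\<close>

lemma D_inj:
  assumes "0 < n" "n < m"
  shows "D m \<noteq> D n"
proof
  assume "D m = D n"
  then have "U m * U (Suc n) - U (Suc m) * U n = 0"
    using U_nonzero[of m] U_nonzero[of n] assms nonzero by (simp add: D_def field_simps)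
  moreover have "U m * U (Suc n) - U (Suc m) * U n = (- of_int a * of_int c) ^ n * U (m - n)"
    using lucas_U_dOcagne[of "of_int b" "- of_int a * of_int c :: real" "m - n" n] assms
    unfolding U_def by simp
  ultimately show False using U_nonzero[of "m - n"] assms nonzero by simp
qed

text \<open>Definedness so far identifies the last two iterates; these are distinct and
  \<open>U\<close> is nonzero at the sum of their indices, so the next denominator is
  nonzero.\<close>

lemma secant_defined_D: "secant_defined f (D 1) (D 2) n"
proof (induction n)
  case (Suc n)
  have "f (secant f (D 1) (D 2) (k + 1)) - f (secant f (D 1) (D 2) k) \<noteq> 0" if k: "k + 2 = Suc n" for k
  proof -
    have "secant_defined f (D 1) (D 2) k" "secant_defined f (D 1) (D 2) (k + 1)"
      using Suc k by (auto simp: secant_defined_def)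
    then have eq: "secant f (D 1) (D 2) k = D (fib (k + 2))"
      "secant f (D 1) (D 2) (k + 1) = D (fib (k + 3))"
      using secant_eq_D[of k] secant_eq_D[of "k + 1"] by (simp_all add: numeral_3_eq_3)
    \<comment> \<open>Strict growth starts at index 2, as \<open>fib 1 = fib 2\<close>.\<close>
    have pos: "0 < fib (k + 2)" "fib (k + 2) < fib (k + 3)"
      by (simp_all add: numeral_3_eq_3 fib_neq_0_nat)
    then show ?thesis
      unfolding eq using D_inj[OF pos] U_nonzero
      by (subst secant_den) auto
  qed
  then show ?case using Suc by (force simp: secant_defined_def le_Suc_eq)
qed (simp add: secant_defined_def)

lemma newton_defined_D: "newton_defined f (D 1) n"
proof (induction n)
  case (Suc n)
  have "deriv f (newton f (D 1) n) \<noteq> 0"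
    using newton_eq_D[OF Suc] U_nonzero[of "2 * 2 ^ n"] by (simp add: deriv_f_D)
  then show ?case using Suc by (auto simp: newton_defined_def less_Suc_eq)
qed (simp add: newton_defined_def)

lemma halley_defined_D: "halley_defined f (D 1) n"
proof (induction n)
  case (Suc n)
  have "halley_den f (halley f (D 1) n) \<noteq> 0"
    using halley_eq_D[OF Suc] U_nonzero[of "3 * 3 ^ n"] by (simp add: halley_den_D)
  then show ?case using Suc by (auto simp: halley_defined_def less_Suc_eq)
qed (simp add: halley_defined_def)

end

section \<open>Convergence to the root of larger modulus\<close>

lemma larger_modulus_root:
  assumes "is_larger_modulus_root (quad a b c) \<alpha>"
  shows "\<And>m. m > 0 \<Longrightarrow> U m \<noteq> 0" and "(\<lambda>m. complex_of_real (D m)) \<longlonglongrightarrow> \<alpha>"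
proof -
  have root: "of_int a * \<alpha>\<^sup>2 - of_int b * \<alpha> - of_int c = 0"
    and dom: "\<And>\<beta>. quad a b c \<beta> = 0 \<Longrightarrow> \<beta> \<noteq> \<alpha> \<Longrightarrow> norm \<beta> < norm \<alpha>"
    using assms by (auto simp: is_larger_modulus_root_def quad_def)
  define x where "x = of_int a * \<alpha>"
  \<comment> \<open>Vieta: the sum fixes the other characteristic root, and the product then follows
    from the equation for \<open>\<alpha>\<close>.\<close>
  define y where "y = of_int b - x"
  define \<beta> where "\<beta> = y / of_int a"
  have y: "y = of_int a * \<beta>" using nonzero by (simp add: \<beta>_def)
  have sum: "x + y = of_int b" by (simp add: y_def)
  have "x * y = - of_int a * (of_int a * \<alpha>\<^sup>2 - of_int b * \<alpha> - of_int c) - of_int a * of_int c"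
    by (simp add: y_def x_def algebra_simps power2_eq_square)
  then have prod: "x * y = - of_int a * of_int c" using root by simp
  have "x \<noteq> 0" using prod nonzero by auto
  have "of_int a * quad a b c \<beta> = y\<^sup>2 - (x + y) * y + x * y"
    unfolding sum prod by (simp add: y quad_def algebra_simps power2_eq_square)
  then have "quad a b c \<beta> = 0" using nonzero by (simp add: algebra_simps power2_eq_square)
  \<comment> \<open>The case \<open>y = x\<close> is that of a double root, where
    \<open>\<beta> = \<alpha>\<close>.\<close>
  then have dom': "y = x \<or> norm y < norm x"
    using dom[of \<beta>] nonzero unfolding y x_def by (auto simp: norm_mult)
  have U: "complex_of_real (U m) = lucas_U (x + y) (x * y) m" for m
  proof -
    \<comment> \<open>The integer sequence links the real one to the complex one.\<close>
    have "U m = of_int (lucas_U b (- a * c) m)"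
      by (simp add: U_def of_int_lucas_U)
    then have "complex_of_real (U m) = of_int (lucas_U b (- a * c) m)"
      by (simp only: of_real_of_int_eq)
    then show ?thesis unfolding sum prod by (simp add: of_int_lucas_U)
  qed
  show nz: "U m \<noteq> 0" if "m > 0" for m
    using lucas_U_nonzero[OF \<open>x \<noteq> 0\<close> dom' that] U[of m] by auto
  \<comment> \<open>Divide the root form of \<open>U (Suc m)\<close> by \<open>a * U m\<close>;
    \<open>m = 0\<close> is left out because \<open>U 0 = 0\<close>.\<close>
  have "complex_of_real (D m) = \<alpha> + y ^ m / lucas_U (x + y) (x * y) m / of_int a" if "m > 0" for m
  proof -
    have "complex_of_real (D m)
        = lucas_U (x + y) (x * y) (Suc m) / (of_int a * lucas_U (x + y) (x * y) m)"
      by (simp add: D_def U)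
    also have "\<dots> = \<alpha> + y ^ m / lucas_U (x + y) (x * y) m / of_int a"
      unfolding lucas_U_Suc_eq_root
      using lucas_U_nonzero[OF \<open>x \<noteq> 0\<close> dom' that] nonzero
      by (simp add: x_def add_divide_distrib)
    finally show ?thesis .
  qed
  then have "\<forall>\<^sub>F m in sequentially.
      \<alpha> + y ^ m / lucas_U (x + y) (x * y) m / of_int a = complex_of_real (D m)"
    by (auto intro: eventually_mono[OF eventually_gt_at_top[of 0]])
  moreover have "(\<lambda>m. \<alpha> + y ^ m / lucas_U (x + y) (x * y) m / of_int a) \<longlonglongrightarrow> \<alpha> + 0 / of_int a"
    using nonzero
    by (intro tendsto_intros root_power_over_lucas_U_tendsto_0 \<open>x \<noteq> 0\<close> dom') auto
  ultimately show "(\<lambda>m. complex_of_real (D m)) \<longlonglongrightarrow> \<alpha>"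
    using Lim_transform_eventually by fastforce
qed

end

section \<open>Convergents along the three index sequences\<close>

theorem theorem4p4:
  fixes a b c :: int and f :: "real \<Rightarrow> real" and q C :: "nat \<Rightarrow> real"
  assumes nz: "a \<noteq> 0" "b \<noteq> 0" "c \<noteq> 0"
    and f: "f = quad a b c"
    and q: "q = cf_den (periodic_quotients a b c)"
    and C: "C = cf_convergent (periodic_quotients a b c)"
  shows
    "((\<forall>n. secant_defined f (C 0) (C 1) n \<longrightarrow>
          q (fib (n + 2) - 1) \<noteq> 0 \<and> C (fib (n + 2) - 1) = secant f (C 0) (C 1) n) \<and>
      (\<forall>\<alpha>. is_larger_modulus_root (quad a b c) \<alpha> \<longrightarrow>
          (\<forall>n. secant_defined f (C 0) (C 1) n) \<and>
          (\<lambda>n. complex_of_real (C (fib (n + 2) - 1))) \<longlonglongrightarrow> \<alpha>)) \<and>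
     ((\<forall>n. newton_defined f (C 0) n \<longrightarrow>
          q (2 ^ n - 1) \<noteq> 0 \<and> C (2 ^ n - 1) = newton f (C 0) n) \<and>
      (\<forall>\<alpha>. is_larger_modulus_root (quad a b c) \<alpha> \<longrightarrow>
          (\<forall>n. newton_defined f (C 0) n) \<and>
          (\<lambda>n. complex_of_real (C (2 ^ n - 1))) \<longlonglongrightarrow> \<alpha>)) \<and>
     ((\<forall>n. halley_defined f (C 0) n \<longrightarrow>
          q (3 ^ n - 1) \<noteq> 0 \<and> C (3 ^ n - 1) = halley f (C 0) n) \<and>
      (\<forall>\<alpha>. is_larger_modulus_root (quad a b c) \<alpha> \<longrightarrow>
          (\<forall>n. halley_defined f (C 0) n) \<and>
          (\<lambda>n. complex_of_real (C (3 ^ n - 1))) \<longlonglongrightarrow> \<alpha>))"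
proof -
  interpret quadratic_cf a b c by unfold_locales (use nz in auto)
  have C0: "C 0 = D 1" and C1: "C 1 = D 2"
    by (simp_all add: C cf_convergent_eq_D numeral_2_eq_2)
  have C_pred: "C (m - 1) = D m" and q_pred: "q (m - 1) \<noteq> 0 \<longleftrightarrow> U m \<noteq> 0" if "m > 0" for m
    using that by (simp_all add: C q cf_convergent_eq_D cf_den_eq_0_iff)
  have pos: "fib (n + 2) > 0" "(2::nat) ^ n > 0" "(3::nat) ^ n > 0" for n
    by (simp_all add: fib_neq_0_nat)
  \<comment> \<open>Strictly increasing indices give subsequences of \<open>D\<close>, so its limit
    serves all three methods.\<close>
  have "strict_mono (\<lambda>n. fib (n + 2))"
    by (simp add: strict_mono_Suc_iff fib_neq_0_nat)
  moreover have "strict_mono (\<lambda>n. (2::nat) ^ n)" "strict_mono (\<lambda>n. (3::nat) ^ n)"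
    by (simp_all add: strict_mono_Suc_iff)
  ultimately have lim:
    "(\<lambda>n. complex_of_real (D (fib (n + 2)))) \<longlonglongrightarrow> \<alpha>"
    "(\<lambda>n. complex_of_real (D (2 ^ n))) \<longlonglongrightarrow> \<alpha>"
    "(\<lambda>n. complex_of_real (D (3 ^ n))) \<longlonglongrightarrow> \<alpha>"
    if "is_larger_modulus_root (quad a b c) \<alpha>" for \<alpha>
    using LIMSEQ_subseq_LIMSEQ[OF larger_modulus_root(2)[OF that]]
    by (auto simp: comp_def)
  note D_pred = C_pred[OF pos(1)] C_pred[OF pos(2)] C_pred[OF pos(3)]
    q_pred[OF pos(1)] q_pred[OF pos(2)] q_pred[OF pos(3)]
  have defined: "secant_defined (quad a b c) (D 1) (D 2) n"
    "newton_defined (quad a b c) (D 1) n" "halley_defined (quad a b c) (D 1) n"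
    if "is_larger_modulus_root (quad a b c) \<alpha>" for \<alpha> n
    using larger_modulus_root(1)[OF that]
    by (blast intro: secant_defined_D newton_defined_D halley_defined_D)+
  show ?thesis
    unfolding f C0 C1 D_pred
    using secant_eq_D newton_eq_D halley_eq_D lim defined
    by (intro conjI allI impI) simp_all
qed

end
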